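(* Let $w_\ell<w_u$ be real numbers and let $w_u\in\mathbb{R}$, $\tilde q>0$, $k_0>0$ satisfy $$\frac{\min\{1,k_0\}}{\sqrt2}\lambda>k_0^2\bigl(1+\tilde q\max\{0,w_u\}\bigr).$$ Let $w\in W_{\mathrm{ad}}$ and let $u\in H^1(\Omega,\mathbb{C})$ solve $$\int_\Omega\nabla u\cdot\nabla\overline v-k_0^2\int_\Omega(1+qw)u\overline v-ik_0\int_{\partial\Omega}u\overline v=k_0^2\int_\Omega qwu_0\overline v\quad\text{for all }v\in H^1(\Omega,\mathbb{C}).$$ Then $$\|u\|_{L^\infty(\Omega,\mathbb{C})}\le\sqrt2\,c_3(\Omega)\,(c_1+c_1c_2+c_2)\,\|u_0\|_{L^2(\Omega,\mathbb{C})}.$$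
   Context: $\Omega\subset\mathbb{R}^2$ is an open square (so $n=2$). $W_{\mathrm{ad}}=\{w\in L^\infty(\Omega):w_\ell\le w\le w_u\text{ a.e.}\}$ (real-valued). $q=\tilde q\,1_{\tilde\Omega}$ for a measurable subset $\tilde\Omega\subset\Omega$; $u_0(x)=\exp(ik_0\,d\cdot x)$ with fixed $d\in\mathbb{R}^2$. Boundary integrals use traces. $\|y\|_{H^1(\Omega,\mathbb{C})}^2=\|y\|_{L^2(\Omega,\mathbb{C})}^2+\|\nabla y\|_{L^2(\Omega,\mathbb{C}^2)}^2$, and $\lambda>0$ is a constant with $\sqrt\lambda\,\|y\|_{H^1(\Omega,\mathbb{C})}\le\sqrt{\|y\|_{L^2(\partial\Omega,\mathbb{C})}^2+\|\nabla y\|_{L^2(\Omega,\mathbb{C}^2)}^2}$ for all $y\in H^1(\Omega,\mathbb{C})$. $C(\Omega)>0$ denotes the constant, depending only on $\Omega$, of the known $H^2$-regularity estimate for the Helmholtz problem with Robin boundary conditions: for every $k>0$ and $g\in L^2(\Omega,\mathbb{C})$, the weak solution $y$ of $-\Delta y-k^2y=g$ in $\Omega$, $\partial_n y=\pm iky$ on $\partial\Omega$ (either sign) satisfies $|y|_{H^2(\Omega,\mathbb{C})}\le C(\Omega)(1+|k|)\|g\|_{L^2(\Omega,\mathbb{C})}$, where $|y|_{H^2(\Omega,\mathbb{C})}=\bigl(\sum_{i,j}\|\partial_{x_i}\partial_{x_j}y\|_{L^2(\Omega,\mathbb{C})}^2\bigr)^{1/2}$. $c_3(\Omega)$ is the embedding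 constant of $H^2(\Omega,\mathbb{C})\hookrightarrow L^\infty(\Omega,\mathbb{C})$, where $\|y\|_{H^2}^2=\|y\|_{H^1}^2+|y|_{H^2}^2$. Further, $c_1:=C(\Omega)(1+|k_0|)k_0^2\tilde q\max\{-w_\ell,w_u\}$, $c_2:=c^{-1}k_0^2\tilde q\max\{-w_\ell,w_u\}$ with $c:=\lambda\min\{1,k_0\}/\sqrt2-k_0^2(1+\tilde q\max\{0,w_u\})$. *)

theory Defs
  imports "HOL-Analysis.Analysis" "HOL-Probability.Essential_Supremum"
begin

section \<open>Lebesgue norms of functions given by representatives\<close>

definition in_L2 :: "'a measure \<Rightarrow> ('a \<Rightarrow> 'b::real_normed_vector) \<Rightarrow> bool" where
  "in_L2 M f \<longleftrightarrow> f \<in> borel_measurable M \<and> integrable M (\<lambda>x. (norm (f x))\<^sup>2)"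

definition norm_L2 :: "'a measure \<Rightarrow> ('a \<Rightarrow> 'b::real_normed_vector) \<Rightarrow> real" where
  "norm_L2 M f = sqrt (LINT x|M. (norm (f x))\<^sup>2)"

text \<open>The essential supremum is extended-real-valued, so for measurable \<open>f\<close> a finite upper bound
  on \<open>norm_Linf M f\<close> includes the membership of \<open>f\<close> in \<open>L\<^sup>\<infinity>\<close>.\<close>

definition norm_Linf :: "'a measure \<Rightarrow> ('a \<Rightarrow> 'b::real_normed_vector) \<Rightarrow> ereal" where
  "norm_Linf M f = esssup M (\<lambda>x. ereal (norm (f x)))"

definition in_Linf :: "'a measure \<Rightarrow> ('a \<Rightarrow> 'b::real_normed_vector) \<Rightarrow> bool" where
  "in_Linf M f \<longleftrightarrow> f \<in> borel_measurable M \<and> norm_Linf M f < \<infinity>"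


section \<open>Smooth functions and test functions\<close>

primrec iter_partial :: "'n list \<Rightarrow> (real^'n \<Rightarrow> complex) \<Rightarrow> real^'n \<Rightarrow> complex" where
  "iter_partial [] f = f"
| "iter_partial (i # \<alpha>) f = (\<lambda>x. frechet_derivative (iter_partial \<alpha> f) (at x) (axis i 1))"

text \<open>All iterated partial derivatives exist and are differentiable, hence continuous; this is
  being of class \<open>C\<^sup>\<infinity>\<close> on the whole space.\<close>

definition smooth :: "(real^'n \<Rightarrow> complex) \<Rightarrow> bool" where
  "smooth f \<longleftrightarrow> (\<forall>\<alpha> x. iter_partial \<alpha> f differentiable (at x))"

definition test_function :: "(real^'n) set \<Rightarrow> (real^'n \<Rightarrow> complex) \<Rightarrow> bool" where
  "test_function \<Omega> \<phi> \<longleftrightarrow>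
     smooth \<phi> \<and> compact (closure {x. \<phi> x \<noteq> 0}) \<and> closure {x. \<phi> x \<noteq> 0} \<subseteq> \<Omega>"


section \<open>Weak derivatives and Sobolev spaces\<close>

definition has_weak_deriv ::
  "(real^'n) set \<Rightarrow> 'n list \<Rightarrow> (real^'n \<Rightarrow> complex) \<Rightarrow> (real^'n \<Rightarrow> complex) \<Rightarrow> bool" where
  "has_weak_deriv \<Omega> \<alpha> y g \<longleftrightarrow>
     in_L2 (lebesgue_on \<Omega>) y \<and> in_L2 (lebesgue_on \<Omega>) g \<and>
     (\<forall>\<phi>. test_function \<Omega> \<phi> \<longrightarrow>
        (LINT x|lebesgue_on \<Omega>. y x * iter_partial \<alpha> \<phi> x)
          = (-1) ^ length \<alpha> * (LINT x|lebesgue_on \<Omega>. g x * \<phi> x))"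

text \<open>On an open set the weak derivative is unique up to null sets, so the choice of
  representative below is immaterial.\<close>

definition weak_deriv ::
  "(real^'n) set \<Rightarrow> 'n list \<Rightarrow> (real^'n \<Rightarrow> complex) \<Rightarrow> real^'n \<Rightarrow> complex" where
  "weak_deriv \<Omega> \<alpha> y = (SOME g. has_weak_deriv \<Omega> \<alpha> y g)"

definition weak_grad :: "(real^'n) set \<Rightarrow> (real^'n \<Rightarrow> complex) \<Rightarrow> real^'n \<Rightarrow> complex^'n" where
  "weak_grad \<Omega> y x = (\<chi> i. weak_deriv \<Omega> [i] y x)"

definition sobolev :: "nat \<Rightarrow> (real^'n) set \<Rightarrow> (real^'n \<Rightarrow> complex) set" where
  "sobolev k \<Omega> =
     {y. in_L2 (lebesgue_on \<Omega>) y \<and> (\<forall>\<alpha>. length \<alpha> \<le> k \<longrightarrow> (\<exists>g. has_weak_deriv \<Omega> \<alpha> y g))}"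

definition norm_H1 :: "(real^'n) set \<Rightarrow> (real^'n \<Rightarrow> complex) \<Rightarrow> real" where
  "norm_H1 \<Omega> y =
     sqrt ((norm_L2 (lebesgue_on \<Omega>) y)\<^sup>2 + (norm_L2 (lebesgue_on \<Omega>) (weak_grad \<Omega> y))\<^sup>2)"

definition seminorm_H2 :: "(real^'n) set \<Rightarrow> (real^'n \<Rightarrow> complex) \<Rightarrow> real" where
  "seminorm_H2 \<Omega> y =
     sqrt (\<Sum>i\<in>UNIV. \<Sum>j\<in>UNIV. (norm_L2 (lebesgue_on \<Omega>) (weak_deriv \<Omega> [i, j] y))\<^sup>2)"

definition norm_H2 :: "(real^'n) set \<Rightarrow> (real^'n \<Rightarrow> complex) \<Rightarrow> real" where
  "norm_H2 \<Omega> y = sqrt ((norm_H1 \<Omega> y)\<^sup>2 + (seminorm_H2 \<Omega> y)\<^sup>2)"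


section \<open>Open squares and their boundary measure\<close>

text \<open>The square with corner \<open>p\<close> and side vectors \<open>a\<close>, \<open>b\<close>, not necessarily parallel to the
  coordinate axes.\<close>

definition is_square_frame :: "real^2 \<Rightarrow> real^2 \<Rightarrow> bool" where
  "is_square_frame a b \<longleftrightarrow> a \<noteq> 0 \<and> norm a = norm b \<and> a \<bullet> b = 0"

definition open_square :: "real^2 \<Rightarrow> real^2 \<Rightarrow> real^2 \<Rightarrow> (real^2) set" where
  "open_square p a b = {p + s *\<^sub>R a + t *\<^sub>R b | s t. 0 < s \<and> s < 1 \<and> 0 < t \<and> t < 1}"

text \<open>Arc length on the boundary: each side, parametrised as \<open>x + t v\<close> with \<open>t\<close> in the unit
  interval, carries the image of Lebesgue measure scaled by the side length.\<close>

definition square_sides :: "real^2 \<Rightarrow> real^2 \<Rightarrow> real^2 \<Rightarrow> ((real^2) \<times> (real^2)) set" where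
  "square_sides p a b = {(p, a), (p + b, a), (p, b), (p + a, b)}"

definition boundary_measure :: "real^2 \<Rightarrow> real^2 \<Rightarrow> real^2 \<Rightarrow> (real^2) measure" where
  "boundary_measure p a b =
     scale_measure (ennreal (norm a))
       (distr (count_space (square_sides p a b) \<Otimes>\<^sub>M restrict_space lborel {0..1}) borel
          (\<lambda>((x, v), t). x + t *\<^sub>R v))"


section \<open>Traces\<close>

text \<open>The trace operator is the continuous extension to \<open>H\<^sup>1\<close> of the restriction to the boundary,
  defined on functions that are smooth up to the boundary. Here \<open>\<sigma>\<close> is the boundary measure;
  the trace is unique up to \<open>\<sigma>\<close>-null sets.\<close>

definition has_trace ::
  "(real^'n) set \<Rightarrow> (real^'n) measure \<Rightarrow> (real^'n \<Rightarrow> complex) \<Rightarrow> (real^'n \<Rightarrow> complex) \<Rightarrow> bool" where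
  "has_trace \<Omega> \<sigma> y t \<longleftrightarrow>
     y \<in> sobolev 1 \<Omega> \<and> in_L2 \<sigma> t \<and>
     (\<exists>\<phi> :: nat \<Rightarrow> real^'n \<Rightarrow> complex.
        (\<forall>n. smooth (\<phi> n)) \<and>
        (\<lambda>n. norm_H1 \<Omega> (\<lambda>x. \<phi> n x - y x)) \<longlonglongrightarrow> 0 \<and>
        (\<lambda>n. norm_L2 \<sigma> (\<lambda>x. \<phi> n x - t x)) \<longlonglongrightarrow> 0)"

definition trace ::
  "(real^'n) set \<Rightarrow> (real^'n) measure \<Rightarrow> (real^'n \<Rightarrow> complex) \<Rightarrow> real^'n \<Rightarrow> complex" where
  "trace \<Omega> \<sigma> y = (SOME t. has_trace \<Omega> \<sigma> y t)"


section \<open>The Helmholtz problem with Robin boundary conditions\<close>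

definition grad_product ::
  "(real^'n) set \<Rightarrow> (real^'n \<Rightarrow> complex) \<Rightarrow> (real^'n \<Rightarrow> complex) \<Rightarrow> complex" where
  "grad_product \<Omega> y v =
     (LINT x|lebesgue_on \<Omega>. (\<Sum>i\<in>UNIV. weak_grad \<Omega> y x $ i * cnj (weak_grad \<Omega> v x $ i)))"

definition boundary_product ::
  "(real^'n) set \<Rightarrow> (real^'n) measure \<Rightarrow> (real^'n \<Rightarrow> complex) \<Rightarrow> (real^'n \<Rightarrow> complex) \<Rightarrow> complex" where
  "boundary_product \<Omega> \<sigma> y v = (LINT x|\<sigma>. trace \<Omega> \<sigma> y x * cnj (trace \<Omega> \<sigma> v x))"

text \<open>Weak solutions of \<open>-\<Delta>y - k\<^sup>2 y = g\<close> in \<open>\<Omega>\<close> with \<open>\<partial>\<^sub>n y = s i k y\<close> on the boundary, where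
  the sign \<open>s\<close> is \<open>1\<close> or \<open>-1\<close>.\<close>

definition helmholtz_robin_solution ::
  "(real^'n) set \<Rightarrow> (real^'n) measure \<Rightarrow> real \<Rightarrow> real \<Rightarrow> (real^'n \<Rightarrow> complex) \<Rightarrow>
     (real^'n \<Rightarrow> complex) \<Rightarrow> bool" where
  "helmholtz_robin_solution \<Omega> \<sigma> k s g y \<longleftrightarrow>
     y \<in> sobolev 1 \<Omega> \<and>
     (\<forall>v\<in>sobolev 1 \<Omega>.
        grad_product \<Omega> y v
          - complex_of_real (k\<^sup>2) * (LINT x|lebesgue_on \<Omega>. y x * cnj (v x))
          - complex_of_real s * \<i> * complex_of_real k * boundary_product \<Omega> \<sigma> y v
        = (LINT x|lebesgue_on \<Omega>. g x * cnj (v x)))"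

definition H2_regularity_constant :: "(real^'n) set \<Rightarrow> (real^'n) measure \<Rightarrow> real \<Rightarrow> bool" where
  "H2_regularity_constant \<Omega> \<sigma> C \<longleftrightarrow>
     0 < C \<and>
     (\<forall>k>0. \<forall>s\<in>{1, -1}. \<forall>g y.
        in_L2 (lebesgue_on \<Omega>) g \<and> helmholtz_robin_solution \<Omega> \<sigma> k s g y \<longrightarrow>
          y \<in> sobolev 2 \<Omega> \<and> seminorm_H2 \<Omega> y \<le> C * (1 + \<bar>k\<bar>) * norm_L2 (lebesgue_on \<Omega>) g)"

definition H2_Linf_embedding_constant :: "(real^'n) set \<Rightarrow> real \<Rightarrow> bool" where
  "H2_Linf_embedding_constant \<Omega> c3 \<longleftrightarrow>
     (\<forall>y\<in>sobolev 2 \<Omega>. norm_Linf (lebesgue_on \<Omega>) y \<le> ereal (c3 * norm_H2 \<Omega> y))"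

definition trace_poincare_constant :: "(real^'n) set \<Rightarrow> (real^'n) measure \<Rightarrow> real \<Rightarrow> bool" where
  "trace_poincare_constant \<Omega> \<sigma> lam \<longleftrightarrow>
     0 < lam \<and>
     (\<forall>y\<in>sobolev 1 \<Omega>.
        sqrt lam * norm_H1 \<Omega> y
          \<le> sqrt ((norm_L2 \<sigma> (trace \<Omega> \<sigma> y))\<^sup>2 + (norm_L2 (lebesgue_on \<Omega>) (weak_grad \<Omega> y))\<^sup>2))"

definition W_ad :: "'a measure \<Rightarrow> real \<Rightarrow> real \<Rightarrow> ('a \<Rightarrow> real) set" where
  "W_ad M wl wu = {w. in_Linf M w \<and> (AE x in M. wl \<le> w x \<and> w x \<le> wu)}"

definition plane_wave :: "real \<Rightarrow> real^'n \<Rightarrow> real^'n \<Rightarrow> complex" where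
  "plane_wave k d x = exp (\<i> * complex_of_real (k * (d \<bullet> x)))"

end

theory Submission
  imports Defs
begin

text \<open>
The proof is a bootstrap from \<open>H\<^sup>1\<close> to \<open>H\<^sup>2\<close> to \<open>L\<^sup>\<infinity>\<close>. Write \<open>Q = qt * max (- wl) wu\<close>, a bound for
\<open>|q w|\<close>, and \<open>U\<close> for the \<open>L\<^sup>2\<close> norm of the incident wave \<open>u0\<close>.

The smallness condition on \<open>k0\<close> makes the sesquilinear form coercive: testing with \<open>u\<close> itself and
using the Poincare-type inequality with constant \<open>lam\<close> gives \<open>\<parallel>u\<parallel>\<^bsub>H\<^sup>1\<^esub> \<le> c2 * U\<close>
(\<open>helmholtz_energy_estimate\<close>). The point to watch is that \<open>1 + q w\<close> may be very negative while \<open>c\<close>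
involves only the upper bound \<open>wu\<close>. This is harmless: if \<open>\<integral> (1 + q w) |u|\<^sup>2\<close> is negative, the
zeroth-order term adds to the gradient term instead of cancelling it (\<open>cmod_coercive\<close>).

Next, \<open>u\<close> solves the constant-coefficient problem with source \<open>k0\<^sup>2 q w (u + u0)\<close>, whose \<open>L\<^sup>2\<close> norm is
at most \<open>k0\<^sup>2 Q (c2 * U + U)\<close>. By \<open>H\<^sup>2\<close> regularity the seminorm of \<open>u\<close> is at most
\<open>c1 * (1 + c2) * U\<close> (\<open>helmholtz_H2_estimate\<close>), so that the full \<open>H\<^sup>2\<close> norm is at most
\<open>(c1 + c1 * c2 + c2) * U\<close>.

Finally the embedding into \<open>L\<^sup>\<infinity>\<close> is applied. To multiply an upper bound of the \<open>H\<^sup>2\<close> norm by \<open>c3\<close>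
one has to know that \<open>c3\<close> is not negative; this follows by inserting the constant function
\<open>1\<close> (\<open>embedding_constant_pos\<close>), which lies in \<open>H\<^sup>2\<close> because derivatives of test functions have
integral zero.
\<close>


section \<open>The space of square-integrable functions\<close>

lemma norm_L2_nonneg: "0 \<le> norm_L2 M f"
  by (simp add: norm_L2_def)

lemma norm_L2_square: "(norm_L2 M f)\<^sup>2 = (LINT x|M. (norm (f x))\<^sup>2)"
  by (simp add: norm_L2_def)

lemma in_L2_norm_mult_integrable:
  fixes f :: "'a \<Rightarrow> 'b::real_normed_vector" and g :: "'a \<Rightarrow> 'c::real_normed_vector"
  assumes "in_L2 M f" "in_L2 M g"
  shows "integrable M (\<lambda>x. norm (f x) * norm (g x))"
proof (rule Bochner_Integration.integrable_bound)
  show "integrable M (\<lambda>x. (norm (f x))\<^sup>2 + (norm (g x))\<^sup>2)"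
    using assms by (simp add: in_L2_def)
  show "(\<lambda>x. norm (f x) * norm (g x)) \<in> borel_measurable M"
    using assms by (auto simp: in_L2_def)
  show "AE x in M. norm (norm (f x) * norm (g x)) \<le> norm ((norm (f x))\<^sup>2 + (norm (g x))\<^sup>2)"
  proof (rule AE_I2)
    fix x
    have "2 * norm (f x) * norm (g x) \<le> (norm (f x))\<^sup>2 + (norm (g x))\<^sup>2"
      by (rule sum_squares_bound)
    moreover have "0 \<le> norm (f x) * norm (g x)"
      by simp
    ultimately have "norm (f x) * norm (g x) \<le> (norm (f x))\<^sup>2 + (norm (g x))\<^sup>2"
      by linarith
    then show "norm (norm (f x) * norm (g x)) \<le> norm ((norm (f x))\<^sup>2 + (norm (g x))\<^sup>2)"
      by simp
  qed
qed

text \<open>The form with norms inside the integral serves both for the complex inner product and for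
Minkowski's inequality. It is the usual discriminant argument: integrating
\<open>(s |f| - t |g|)\<^sup>2 \<ge> 0\<close> gives an inequality quadratic in \<open>s\<close> and \<open>t\<close>, and the best choice
is \<open>s = \<parallel>g\<parallel>\<close>, \<open>t = \<parallel>f\<parallel>\<close>.\<close>

lemma Cauchy_Schwarz_L2:
  fixes f :: "'a \<Rightarrow> 'b::real_normed_vector" and g :: "'a \<Rightarrow> 'c::real_normed_vector"
  assumes f: "in_L2 M f" and g: "in_L2 M g"
  shows "(LINT x|M. norm (f x) * norm (g x)) \<le> norm_L2 M f * norm_L2 M g"
proof -
  define A where "A = norm_L2 M f"
  define B where "B = norm_L2 M g"
  define I where "I = (LINT x|M. norm (f x) * norm (g x))"
  have A: "0 \<le> A" and B: "0 \<le> B"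
    by (simp_all add: A_def B_def norm_L2_nonneg)
  have int: "integrable M (\<lambda>x. (norm (f x))\<^sup>2)" "integrable M (\<lambda>x. (norm (g x))\<^sup>2)"
    "integrable M (\<lambda>x. norm (f x) * norm (g x))"
    using f g in_L2_norm_mult_integrable[OF f g] by (auto simp: in_L2_def)
  have quad: "2 * (s * t) * I \<le> s\<^sup>2 * A\<^sup>2 + t\<^sup>2 * B\<^sup>2" for s t
  proof -
    have "0 \<le> (LINT x|M. (s * norm (f x) - t * norm (g x))\<^sup>2)"
      by (intro integral_nonneg_AE AE_I2) simp
    also have "\<dots> = (LINT x|M. s\<^sup>2 * (norm (f x))\<^sup>2 + t\<^sup>2 * (norm (g x))\<^sup>2
        - 2 * (s * t) * (norm (f x) * norm (g x)))"
      by (rule Bochner_Integration.integral_cong) (auto simp: power2_eq_square algebra_simps)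
    also have "\<dots> = s\<^sup>2 * A\<^sup>2 + t\<^sup>2 * B\<^sup>2 - 2 * (s * t) * I"
      using int by (simp add: A_def B_def I_def norm_L2_square)
    finally show ?thesis by simp
  qed
  \<comment> \<open>The optimal \<open>s\<close> and \<open>t\<close> are shifted by \<open>e\<close>, so that one may divide by them even if a norm
    vanishes.\<close>
  have regularised: "I \<le> (A + e) * (B + e)" if e: "0 < e" for e
  proof -
    have "2 * ((B + e) * (A + e)) * I \<le> (B + e)\<^sup>2 * A\<^sup>2 + (A + e)\<^sup>2 * B\<^sup>2"
      by (rule quad)
    also have "\<dots> \<le> (B + e)\<^sup>2 * (A + e)\<^sup>2 + (A + e)\<^sup>2 * (B + e)\<^sup>2"
      using A B e by (intro add_mono mult_left_mono power_mono) auto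
    also have "\<dots> = 2 * ((B + e) * (A + e)) * ((A + e) * (B + e))"
      by (simp add: power2_eq_square algebra_simps)
    finally show ?thesis
      using A B e by (simp add: mult_le_cancel_left add_nonneg_pos less_not_sym)
  qed
  have "((\<lambda>e. (A + e) * (B + e)) \<longlongrightarrow> (A + 0) * (B + 0)) (at_right 0)"
    by (intro tendsto_intros)
  then have "I \<le> (A + 0) * (B + 0)"
    by (rule tendsto_lowerbound)
      (auto simp: regularised eventually_at_right_less intro: eventually_mono[OF eventually_at_right_less])
  then show ?thesis by (simp add: A_def B_def I_def)
qed

lemma norm_L2_triangle:
  fixes f g :: "'a \<Rightarrow> 'b::{real_normed_vector, second_countable_topology}"
  assumes f: "in_L2 M f" and g: "in_L2 M g"
  shows "in_L2 M (\<lambda>x. f x + g x)" "norm_L2 M (\<lambda>x. f x + g x) \<le> norm_L2 M f + norm_L2 M g"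
proof -
  have meas: "f \<in> borel_measurable M" "g \<in> borel_measurable M"
    using f g by (auto simp: in_L2_def)
  let ?h = "\<lambda>x. (norm (f x))\<^sup>2 + 2 * (norm (f x) * norm (g x)) + (norm (g x))\<^sup>2"
  have int: "integrable M (\<lambda>x. (norm (f x))\<^sup>2)" "integrable M (\<lambda>x. (norm (g x))\<^sup>2)"
    "integrable M (\<lambda>x. norm (f x) * norm (g x))"
    using f g in_L2_norm_mult_integrable[OF f g] by (auto simp: in_L2_def)
  then have inth: "integrable M ?h" by auto
  have le: "(norm (f x + g x))\<^sup>2 \<le> ?h x" for x
  proof -
    have "(norm (f x + g x))\<^sup>2 \<le> (norm (f x) + norm (g x))\<^sup>2"
      by (intro power_mono norm_triangle_ineq) simp
    then show ?thesis by (simp add: power2_eq_square algebra_simps)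
  qed
  have int_sum: "integrable M (\<lambda>x. (norm (f x + g x))\<^sup>2)"
    by (rule Bochner_Integration.integrable_bound[OF inth])
      (use meas le in \<open>auto intro!: AE_I2 order_trans[OF le]\<close>)
  then show "in_L2 M (\<lambda>x. f x + g x)"
    using meas by (auto simp: in_L2_def)
  have "(norm_L2 M (\<lambda>x. f x + g x))\<^sup>2 \<le> (LINT x|M. ?h x)"
    unfolding norm_L2_square by (intro integral_mono int_sum inth le)
  also have "\<dots> = (norm_L2 M f)\<^sup>2 + 2 * (LINT x|M. norm (f x) * norm (g x)) + (norm_L2 M g)\<^sup>2"
    using int by (simp add: norm_L2_square)
  also have "\<dots> \<le> (norm_L2 M f + norm_L2 M g)\<^sup>2"
    using Cauchy_Schwarz_L2[OF f g] by (simp add: power2_sum)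
  finally show "norm_L2 M (\<lambda>x. f x + g x) \<le> norm_L2 M f + norm_L2 M g"
    by (rule power2_le_imp_le) (simp add: norm_L2_nonneg)
qed

text \<open>This is how the bounded coefficients of the equation act on \<open>L\<^sup>2\<close>: the pointwise bound is only
available almost everywhere.\<close>

lemma L2_dominated:
  fixes f :: "'a \<Rightarrow> 'b::real_normed_vector" and h :: "'a \<Rightarrow> 'c::real_normed_vector"
  assumes h: "in_L2 M h" and f: "f \<in> borel_measurable M"
    and K: "0 \<le> K" and le: "AE x in M. norm (f x) \<le> K * norm (h x)"
  shows "in_L2 M f" "norm_L2 M f \<le> K * norm_L2 M h"
proof -
  have int: "integrable M (\<lambda>x. K\<^sup>2 * (norm (h x))\<^sup>2)"
    using h by (simp add: in_L2_def)
  have le2: "AE x in M. (norm (f x))\<^sup>2 \<le> K\<^sup>2 * (norm (h x))\<^sup>2"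
    using le by eventually_elim (metis norm_ge_zero power_mono power_mult_distrib)
  have intf: "integrable M (\<lambda>x. (norm (f x))\<^sup>2)"
    by (rule Bochner_Integration.integrable_bound[OF int]) (use f le2 in auto)
  then show "in_L2 M f"
    using f by (simp add: in_L2_def)
  have "(norm_L2 M f)\<^sup>2 \<le> (LINT x|M. K\<^sup>2 * (norm (h x))\<^sup>2)"
    unfolding norm_L2_square by (rule integral_mono_AE[OF intf int le2])
  also have "\<dots> = (K * norm_L2 M h)\<^sup>2"
    by (simp add: power_mult_distrib norm_L2_square)
  finally show "norm_L2 M f \<le> K * norm_L2 M h"
    by (rule power2_le_imp_le) (simp add: K norm_L2_nonneg)
qed

lemma L2_inner_product:
  fixes f g :: "'a \<Rightarrow> complex"
  assumes f: "in_L2 M f" and g: "in_L2 M g"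
  shows "integrable M (\<lambda>x. f x * cnj (g x))"
    "cmod (LINT x|M. f x * cnj (g x)) \<le> norm_L2 M f * norm_L2 M g"
proof -
  have "cnj \<in> borel_measurable borel"
    by (intro borel_measurable_continuous_onI continuous_intros)
  then have "(\<lambda>x. f x * cnj (g x)) \<in> borel_measurable M"
    using f g by (auto simp: in_L2_def)
  then show "integrable M (\<lambda>x. f x * cnj (g x))"
    by (rule Bochner_Integration.integrable_bound[OF in_L2_norm_mult_integrable[OF f g]])
      (auto simp: norm_mult)
  have "cmod (LINT x|M. f x * cnj (g x)) \<le> (LINT x|M. cmod (f x * cnj (g x)))"
    by (rule integral_norm_bound)
  also have "\<dots> \<le> norm_L2 M f * norm_L2 M g"
    using Cauchy_Schwarz_L2[OF f g] by (simp add: norm_mult)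
  finally show "cmod (LINT x|M. f x * cnj (g x)) \<le> norm_L2 M f * norm_L2 M g" .
qed


section \<open>Test functions and constants\<close>

lemma iter_partial_append: "iter_partial (\<alpha> @ \<beta>) f = iter_partial \<alpha> (iter_partial \<beta> f)"
  by (induction \<alpha>) auto

lemma smooth_iter_partial: "smooth f \<Longrightarrow> smooth (iter_partial \<alpha> f)"
  unfolding smooth_def iter_partial_append[symmetric] by blast

lemma zero_outside_support: "x \<notin> closure {x. f x \<noteq> 0} \<Longrightarrow> f x = 0"
  using subsetD[OF closure_subset, of x "{x. f x \<noteq> 0}"] by blast

lemma iter_partial_support:
  "x \<notin> closure {x. f x \<noteq> 0} \<Longrightarrow> iter_partial \<alpha> f x = 0"
proof (induction \<alpha> arbitrary: x)
  case Nil
  then have "f x = 0" by (rule zero_outside_support)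
  then show ?case by simp
next
  case (Cons i \<alpha>)
  \<comment> \<open>Off the closed support, the derivative vanishes because the function vanishes on a
    whole neighbourhood.\<close>
  let ?U = "- closure {x. f x \<noteq> 0}"
  have "(iter_partial \<alpha> f has_derivative (\<lambda>_. 0)) (at x)"
    by (rule has_derivative_transform_within_open[OF has_derivative_const, of ?U])
      (use Cons in auto)
  from frechet_derivative_at[OF this] show ?case
    by (metis iter_partial.simps(2))
qed

lemma test_function_iter_partial:
  assumes "test_function \<Omega> \<phi>"
  shows "test_function \<Omega> (iter_partial \<alpha> \<phi>)"
proof -
  have sub: "closure {x. iter_partial \<alpha> \<phi> x \<noteq> 0} \<subseteq> closure {x. \<phi> x \<noteq> 0}"
  proof (rule closure_minimal)
    show "{x. iter_partial \<alpha> \<phi> x \<noteq> 0} \<subseteq> closure {x. \<phi> x \<noteq> 0}"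
      using iter_partial_support[of _ \<phi> \<alpha>] by blast
  qed simp
  have "compact (closure {x. iter_partial \<alpha> \<phi> x \<noteq> 0})"
    using assms sub by (auto simp: test_function_def compact_eq_bounded_closed intro: bounded_subset)
  then show ?thesis
    using assms smooth_iter_partial[of \<phi> \<alpha>] sub unfolding test_function_def by blast
qed

lemma smooth_continuous: "smooth f \<Longrightarrow> continuous_on UNIV f"
proof (intro continuous_at_imp_continuous_on ballI)
  fix x assume "smooth f"
  then have "f differentiable (at x)"
    unfolding smooth_def by (metis iter_partial.simps(1))
  then show "isCont f x"
    by (rule differentiable_imp_continuous_within)
qed

lemma LINT_lborel_translate:
  fixes f :: "'a::euclidean_space \<Rightarrow> 'b::{banach, second_countable_topology}"
  assumes [measurable]: "f \<in> borel_measurable borel"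
  shows "(LINT x|lborel. f (v + x)) = (LINT x|lborel. f x)"
proof -
  have "(LINT x|lborel. f x) = (LINT x|distr lborel borel ((+) v). f x)"
    by (simp add: lborel_distr_plus)
  also have "\<dots> = (LINT x|lborel. f (v + x))"
    by (rule integral_distr) auto
  finally show ?thesis by simp
qed

text \<open>The integral of \<open>\<psi>\<close> does not change under translation, so every difference quotient of \<open>\<psi>\<close> in
direction \<open>i\<close> has integral zero. The difference quotients converge to the partial derivative and are
dominated, by the mean value inequality, by a constant on a bounded set; hence the integral of the
limit is zero too.\<close>

lemma integral_partial_test_function_eq_0:
  fixes \<psi> :: "real^'n \<Rightarrow> complex"
  assumes test: "test_function \<Omega> \<psi>"
  shows "(LINT x|lborel. iter_partial [i] \<psi> x) = 0"
proof -
  define D where "D = iter_partial [i] \<psi>"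
  define e :: "real^'n" where "e = axis i 1"
  define K where "K = closure {x. \<psi> x \<noteq> 0}"
  \<comment> \<open>All translates that occur have length at most \<open>1\<close>, so the difference quotients vanish off \<open>K'\<close>.\<close>
  define K' where "K' = {x + y | x y. x \<in> K \<and> y \<in> cball 0 1}"
  define h where "h n = inverse (real (Suc n))" for n
  define s where "s n x = (\<psi> (h n *\<^sub>R e + x) - \<psi> x) /\<^sub>R h n" for n x
  have smooth: "smooth \<psi>" and K: "compact K"
    using test by (auto simp: test_function_def K_def)
  have zero: "\<psi> x = 0" if "x \<notin> K" for x
    using that unfolding K_def by (rule zero_outside_support)
  have contD: "continuous_on UNIV D"
    unfolding D_def by (intro smooth_continuous smooth_iter_partial smooth)
  have cont: "continuous_on UNIV \<psi>"
    by (intro smooth_continuous smooth)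
  have [measurable]: "\<psi> \<in> borel_measurable borel" "D \<in> borel_measurable borel"
    by (intro borel_measurable_continuous_onI cont contD)+
  have K': "compact K'"
    unfolding K'_def by (intro compact_sums K compact_cball)
  have h: "0 < h n" "h n \<le> 1" for n
    by (auto simp: h_def field_simps)
  have deriv: "((\<lambda>t. \<psi> (t *\<^sub>R e + x)) has_vector_derivative D (t *\<^sub>R e + x)) (at t within S)" for x t S
  proof -
    have diff: "\<psi> differentiable (at (t *\<^sub>R e + x))"
      using smooth[unfolded smooth_def, THEN spec, of "[]"] by simp
    then have "(\<psi> has_derivative frechet_derivative \<psi> (at (t *\<^sub>R e + x))) (at (t *\<^sub>R e + x))"
      by (simp add: frechet_derivative_works)
    then have "((\<lambda>t. \<psi> (t *\<^sub>R e + x)) has_derivative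
        (\<lambda>s. frechet_derivative \<psi> (at (t *\<^sub>R e + x)) (s *\<^sub>R e))) (at t)"
      by (rule has_derivative_compose[rotated]) (auto intro!: derivative_eq_intros)
    moreover have "frechet_derivative \<psi> (at (t *\<^sub>R e + x)) (s *\<^sub>R e) = s *\<^sub>R D (t *\<^sub>R e + x)" for s
    proof -
      have "linear (frechet_derivative \<psi> (at (t *\<^sub>R e + x)))"
        by (rule linear_frechet_derivative[OF diff])
      then show ?thesis
        by (simp add: linear_cmul D_def e_def)
    qed
    ultimately show ?thesis
      unfolding has_vector_derivative_def by (auto intro: has_derivative_at_withinI)
  qed
  obtain B where B: "\<And>x. norm (D x) \<le> B" "0 \<le> B"
  proof -
    have "bounded (D ` K)"
      by (intro compact_imp_bounded compact_continuous_image K continuous_on_subset[OF contD]) auto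
    then obtain B where B: "0 < B" "\<forall>y\<in>D ` K. norm y \<le> B"
      unfolding bounded_pos by blast
    have "norm (D x) \<le> B" for x
    proof (cases "x \<in> K")
      case False
      then show ?thesis
        using B iter_partial_support[of x \<psi> "[i]"] by (simp add: D_def K_def)
    qed (use B in auto)
    then show ?thesis using that B by force
  qed
  have lim: "(\<lambda>n. s n x) \<longlonglongrightarrow> D x" for x
  proof -
    have "((\<lambda>t. (\<psi> (t *\<^sub>R e + x) - \<psi> x) /\<^sub>R t) \<longlongrightarrow> D x) (at 0)"
    proof (rule LIM_zero_cancel, rule tendsto_norm_zero_cancel)
      have "(\<lambda>t. norm (\<psi> (t *\<^sub>R e + x) - \<psi> x - t *\<^sub>R D x) / norm t) \<midarrow>0\<rightarrow> 0"
        using deriv[of x 0 UNIV] by (simp add: has_vector_derivative_def has_derivative_at)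
      then show "(\<lambda>t. norm ((\<psi> (t *\<^sub>R e + x) - \<psi> x) /\<^sub>R t - D x)) \<midarrow>0\<rightarrow> 0"
      proof (rule Lim_transform_eventually)
        have "norm (\<psi> (t *\<^sub>R e + x) - \<psi> x - t *\<^sub>R D x) / norm t
            = norm ((\<psi> (t *\<^sub>R e + x) - \<psi> x) /\<^sub>R t - D x)" if "t \<noteq> 0" for t
        proof -
          have "(\<psi> (t *\<^sub>R e + x) - \<psi> x) /\<^sub>R t - D x
              = (\<psi> (t *\<^sub>R e + x) - \<psi> x - t *\<^sub>R D x) /\<^sub>R t"
            using that by (simp add: scaleR_diff_right)
          then show ?thesis by (simp add: divide_inverse mult.commute)
        qed
        then show "\<forall>\<^sub>F t in at 0. norm (\<psi> (t *\<^sub>R e + x) - \<psi> x - t *\<^sub>R D x) / norm t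
            = norm ((\<psi> (t *\<^sub>R e + x) - \<psi> x) /\<^sub>R t - D x)"
          by (auto simp: eventually_at_filter)
      qed
    qed
    moreover have "filterlim h (at 0) sequentially"
      unfolding filterlim_at using h LIMSEQ_inverse_real_of_nat
      unfolding h_def by (auto simp: less_imp_neq[symmetric])
    ultimately show ?thesis
      unfolding s_def by (rule filterlim_compose)
  qed
  have bound: "norm (s n x) \<le> B * indicator K' x" for n x
  proof (cases "x \<in> K'")
    case True
    have "norm (\<psi> (h n *\<^sub>R e + x) - \<psi> (0 *\<^sub>R e + x)) \<le> B * norm (h n - 0)"
      by (rule differentiable_bound[of "{0..h n}" _ "\<lambda>t s. s *\<^sub>R D (t *\<^sub>R e + x)"])
        (use deriv h B(2) in \<open>auto simp: has_vector_derivative_def less_imp_le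
            intro!: onorm_bound mult_mono B(1) simp: mult.commute[of B]\<close>)
    then show ?thesis
      using True h[of n] by (simp add: s_def divide_simps mult.commute)
  next
    case False
    have "0 \<in> cball (0::real^'n) 1" "- (h n *\<^sub>R e) \<in> cball 0 1"
      using h[of n] by (auto simp: e_def)
    moreover have "x = x + 0" "x = (h n *\<^sub>R e + x) + - (h n *\<^sub>R e)"
      by simp_all
    ultimately have "x \<notin> K" "h n *\<^sub>R e + x \<notin> K"
      using False unfolding K'_def by blast+
    then have "\<psi> x = 0" "\<psi> (h n *\<^sub>R e + x) = 0"
      by (simp_all add: zero)
    then show ?thesis using B by (simp add: s_def)
  qed
  have int_bound: "integrable lborel (\<lambda>x. B * indicator K' x)"
    using K' emeasure_compact_finite[OF K'] by (simp add: compact_imp_closed less_top)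
  have lim_int: "(\<lambda>n. LINT x|lborel. s n x) \<longlonglongrightarrow> (LINT x|lborel. D x)"
  proof (rule integral_dominated_convergence[OF _ _ int_bound])
    show "s n \<in> borel_measurable lborel" for n
    proof -
      have "continuous_on UNIV (s n)"
        unfolding s_def[abs_def] by (intro continuous_intros cont continuous_on_compose2[OF cont]) auto
      then show ?thesis
        by (simp add: borel_measurable_continuous_onI)
    qed
    show "AE x in lborel. (\<lambda>n. s n x) \<longlonglongrightarrow> D x"
      by (rule AE_I2) (rule lim)
    show "AE x in lborel. norm (s n x) \<le> B * indicator K' x" for n
      by (rule AE_I2) (rule bound)
  qed simp
  have int_psi: "integrable lborel \<psi>"
  proof -
    have "integrable lborel (\<lambda>x. indicator K x *\<^sub>R \<psi> x)"
      using borel_integrable_compact[OF K continuous_on_subset[OF cont]] by (simp add: indicator_def if_distrib cong: if_cong)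
    also have "(\<lambda>x. indicator K x *\<^sub>R \<psi> x) = \<psi>"
      by (auto simp: indicator_def fun_eq_iff zero)
    finally show ?thesis .
  qed
  have "(LINT x|lborel. s n x) = 0" for n
  proof -
    have "integrable lborel (\<lambda>x. \<psi> (h n *\<^sub>R e + x))"
    proof -
      have "integrable (distr lborel borel ((+) (h n *\<^sub>R e))) \<psi>"
        using int_psi by (simp add: lborel_distr_plus)
      moreover have "(+) (h n *\<^sub>R e) \<in> lborel \<rightarrow>\<^sub>M borel"
        by auto
      ultimately show ?thesis
        by (rule integrable_distr[rotated])
    qed
    then have "(LINT x|lborel. s n x)
        = ((LINT x|lborel. \<psi> (h n *\<^sub>R e + x)) - (LINT x|lborel. \<psi> x)) /\<^sub>R h n"
      using int_psi unfolding s_def by simp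
    also have "\<dots> = 0"
      by (simp only: LINT_lborel_translate[OF \<open>\<psi> \<in> borel_measurable borel\<close>]
          diff_self scaleR_zero_right)
    finally show ?thesis .
  qed
  with lim_int have "(LINT x|lborel. D x) = 0"
    by (simp add: LIMSEQ_const_iff)
  then show ?thesis by (simp add: D_def)
qed

lemma integral_iter_partial_eq_0:
  assumes \<Omega>: "\<Omega> \<in> sets lebesgue" and test: "test_function \<Omega> \<phi>" and ne: "\<alpha> \<noteq> []"
  shows "(LINT x|lebesgue_on \<Omega>. iter_partial \<alpha> \<phi> x) = 0"
proof -
  obtain i \<beta> where \<alpha>: "\<alpha> = i # \<beta>" using ne by (cases \<alpha>) auto
  define \<psi> where "\<psi> = iter_partial \<alpha> \<phi>"
  have \<psi>: "test_function \<Omega> \<psi>"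
    unfolding \<psi>_def by (rule test_function_iter_partial[OF test])
  have meas: "\<psi> \<in> borel_measurable borel"
    using \<psi> by (auto simp: test_function_def intro!: borel_measurable_continuous_onI smooth_continuous)
  have supp: "indicator \<Omega> x *\<^sub>R \<psi> x = \<psi> x" for x
  proof (cases "x \<in> \<Omega>")
    case False
    with \<psi> have "x \<notin> closure {x. \<psi> x \<noteq> 0}"
      unfolding test_function_def by blast
    then have "\<psi> x = 0"
      by (rule zero_outside_support)
    then show ?thesis by simp
  qed simp
  have "(LINT x|lebesgue_on \<Omega>. \<psi> x) = (LINT x|lebesgue. \<psi> x)"
    using \<Omega> by (simp add: integral_restrict_space supp)
  also have "\<dots> = (LINT x|lborel. \<psi> x)"
    using meas by (intro integral_completion) simp
  also have "\<dots> = 0"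
    using integral_partial_test_function_eq_0[OF test_function_iter_partial[OF test, of \<beta>], of i]
    by (simp add: \<psi>_def \<alpha>)
  finally show ?thesis by (simp add: \<psi>_def)
qed

lemma in_L2_const:
  assumes "\<Omega> \<in> lmeasurable"
  shows "in_L2 (lebesgue_on \<Omega>) (\<lambda>_. c)"
  using assms by (auto simp: in_L2_def fmeasurable_def emeasure_restrict_space
      intro!: finite_measure.integrable_const finite_measureI)

text \<open>The weak derivatives of positive order vanish, because derivatives of test functions have
integral zero.\<close>

lemma one_in_sobolev:
  assumes "\<Omega> \<in> lmeasurable"
  shows "(\<lambda>_. 1) \<in> sobolev k \<Omega>"
proof -
  have "has_weak_deriv \<Omega> \<alpha> (\<lambda>_. 1) (\<lambda>_. if \<alpha> = [] then 1 else 0)" for \<alpha>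
    using integral_iter_partial_eq_0[of \<Omega>] assms
    by (auto simp: has_weak_deriv_def in_L2_const)
  then show ?thesis
    using in_L2_const[OF assms] by (auto simp: sobolev_def)
qed

text \<open>The embedding inequality alone does not display the sign of its constant. Testing it with the
constant function \<open>1\<close>, whose supremum norm is \<open>1\<close>, excludes \<open>c3 \<le> 0\<close>; positivity is what allows
an upper bound of the \<open>H\<^sup>2\<close> norm to be multiplied by \<open>c3\<close>.\<close>

lemma embedding_constant_pos:
  assumes emb: "H2_Linf_embedding_constant \<Omega> c3"
    and \<Omega>: "open \<Omega>" "bounded \<Omega>" "\<Omega> \<noteq> {}"
  shows "0 < c3"
proof -
  have lm: "\<Omega> \<in> lmeasurable"
    by (rule lmeasurable_open[OF \<Omega>(2,1)])
  have "\<Omega> \<notin> null_sets lebesgue"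
    using open_not_negligible[OF \<Omega>(1,3)] by (simp add: negligible_iff_null_sets)
  then have "emeasure (lebesgue_on \<Omega>) (space (lebesgue_on \<Omega>)) \<noteq> 0"
    using lm by (auto simp: emeasure_restrict_space null_sets_def)
  then have "norm_Linf (lebesgue_on \<Omega>) (\<lambda>_. 1 :: complex) = 1"
    by (simp add: norm_Linf_def esssup_const one_ereal_def)
  moreover have "norm_Linf (lebesgue_on \<Omega>) (\<lambda>_. 1 :: complex) \<le> ereal (c3 * norm_H2 \<Omega> (\<lambda>_. 1))"
    using emb one_in_sobolev[OF lm] unfolding H2_Linf_embedding_constant_def by blast
  ultimately have "1 \<le> c3 * norm_H2 \<Omega> (\<lambda>_. 1)"
    by (simp add: one_ereal_def)
  moreover have "0 \<le> norm_H2 \<Omega> (\<lambda>_. 1)"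
    by (simp add: norm_H2_def)
  ultimately show ?thesis
    by (smt (verit) mult_nonpos_nonneg)
qed


section \<open>Geometry of squares\<close>

text \<open>Topological properties of a tilted square are read off from the
unit square through an affine map.\<close>

lemma open_square_eq_image:
  "open_square p a b = (+) p ` (\<lambda>z :: real^2. z $ 1 *\<^sub>R a + z $ 2 *\<^sub>R b) ` {z. \<forall>i. 0 < z $ i \<and> z $ i < 1}"
  (is "_ = (+) p ` ?f ` ?Q")
proof -
  have "p + s *\<^sub>R a + t *\<^sub>R b \<in> (+) p ` ?f ` ?Q" if "0 < s" "s < 1" "0 < t" "t < 1" for s t
  proof -
    have "vector [s, t] \<in> ?Q"
      using that by (auto simp: forall_2 vector_2)
    moreover have "p + s *\<^sub>R a + t *\<^sub>R b = p + ?f (vector [s, t])"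
      by (simp add: vector_2 add.assoc)
    ultimately show ?thesis by blast
  qed
  moreover have "p + ?f z \<in> open_square p a b" if "z \<in> ?Q" for z
    using that unfolding open_square_def add.assoc by blast
  ultimately show ?thesis
    unfolding open_square_def by blast
qed

lemma open_square_properties:
  assumes frame: "is_square_frame a b"
  shows "open (open_square p a b)" "bounded (open_square p a b)" "open_square p a b \<noteq> {}"
proof -
  let ?f = "\<lambda>z :: real^2. z $ 1 *\<^sub>R a + z $ 2 *\<^sub>R b"
  let ?Q = "{z :: real^2. \<forall>i. 0 < z $ i \<and> z $ i < 1}"
  have lin: "linear ?f"
    by (rule linearI) (auto simp: algebra_simps)
  have "inj ?f"
  proof (subst linear_injective_0[OF lin], intro allI impI)
    fix z assume z: "?f z = 0"
    have "z $ 1 * (a \<bullet> a) = ?f z \<bullet> a" "z $ 2 * (b \<bullet> b) = ?f z \<bullet> b"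
      using frame by (auto simp: is_square_frame_def inner_left_distrib inner_commute[of b a])
    with z frame have "z $ 1 = 0" "z $ 2 = 0"
      by (auto simp: is_square_frame_def)
    then show "z = 0"
      by (simp add: vec_eq_iff forall_2)
  qed
  then have surj: "surj ?f"
    by (rule linear_injective_imp_surjective[OF lin]) simp
  have Q: "?Q = box 0 1"
    by (auto simp: mem_box_cart)
  show "open (open_square p a b)"
    unfolding open_square_eq_image Q
    by (intro open_translation open_surjective_linear_image[OF _ lin surj] open_box)
  show "bounded (open_square p a b)"
    unfolding open_square_eq_image Q
    by (intro bounded_translation bounded_linear_image bounded_box)
      (use lin in \<open>simp add: linear_conv_bounded_linear\<close>)
  have "p + (1/2) *\<^sub>R a + (1/2) *\<^sub>R b \<in> open_square p a b"
    unfolding open_square_def by (intro CollectI exI[of _ "1/2"]) auto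
  then show "open_square p a b \<noteq> {}" by blast
qed


section \<open>A priori estimates for the Helmholtz equation\<close>

lemma norm_L2_le_norm_H1: "norm_L2 (lebesgue_on \<Omega>) y \<le> norm_H1 \<Omega> y"
  unfolding norm_H1_def by (rule real_le_rsqrt) simp

lemma norm_H2_le: "norm_H2 \<Omega> y \<le> norm_H1 \<Omega> y + seminorm_H2 \<Omega> y"
  unfolding norm_H2_def norm_H1_def seminorm_H2_def
  by (rule sqrt_sum_squares_le_sum) (auto intro!: sum_nonneg)

text \<open>Subtracting a negative \<open>r\<close> moves \<open>A - i k B\<close> away from the origin, since \<open>A \<ge> 0\<close>; subtracting
a positive one costs, by the triangle inequality, at most \<open>r \<le> R\<close>. So one-sided control of \<open>r\<close>
suffices. In the application \<open>A\<close> is the squared norm of the gradient, \<open>B\<close> that of the trace, and \<open>r\<close> the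
contribution of the zeroth-order term, and this is why only the positive part of the upper bound of
the contrast enters the coercivity constant. The factor \<open>1 / sqrt 2\<close> comes from
\<open>x + y \<le> sqrt 2 * sqrt (x\<^sup>2 + y\<^sup>2)\<close>.\<close>

lemma cmod_coercive:
  fixes A B r R k :: real
  assumes "0 \<le> A" "0 \<le> B" "0 < k" "r \<le> R" "0 \<le> R"
  shows "min 1 k / sqrt 2 * (A + B) \<le> R + cmod (of_real A - of_real r - \<i> * of_real k * of_real B)"
proof -
  have "min 1 k * (A + B) \<le> A + k * B"
  proof -
    have "min 1 k * A \<le> 1 * A" "min 1 k * B \<le> k * B"
      using assms by (intro mult_right_mono; simp)+
    then show ?thesis by (simp add: algebra_simps)
  qed
  then have "min 1 k * (A + B) / sqrt 2 \<le> (A + k * B) / sqrt 2"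
    by (rule divide_right_mono) simp
  also have "\<dots> \<le> sqrt (A\<^sup>2 + (k * B)\<^sup>2)"
  proof (rule real_le_rsqrt)
    have "2 * A * (k * B) \<le> A\<^sup>2 + (k * B)\<^sup>2"
      by (rule sum_squares_bound)
    then show "((A + k * B) / sqrt 2)\<^sup>2 \<le> A\<^sup>2 + (k * B)\<^sup>2"
      by (simp add: power_divide power2_sum)
  qed
  also have "\<dots> \<le> R + sqrt ((A - r)\<^sup>2 + (k * B)\<^sup>2)"
  proof (cases "r \<le> 0")
    case True
    then have "A\<^sup>2 \<le> (A - r)\<^sup>2"
      using assms by (intro power_mono) auto
    then have "sqrt (A\<^sup>2 + (k * B)\<^sup>2) \<le> sqrt ((A - r)\<^sup>2 + (k * B)\<^sup>2)"
      by simp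
    with assms show ?thesis by linarith
  next
    case False
    have "sqrt ((r + (A - r))\<^sup>2 + (0 + k * B)\<^sup>2) \<le> sqrt (r\<^sup>2 + 0\<^sup>2) + sqrt ((A - r)\<^sup>2 + (k * B)\<^sup>2)"
      by (rule real_sqrt_sum_squares_triangle_ineq)
    with False assms show ?thesis by simp
  qed
  also have "sqrt ((A - r)\<^sup>2 + (k * B)\<^sup>2) = cmod (of_real A - of_real r - \<i> * of_real k * of_real B)"
    by (simp add: cmod_def)
  finally show ?thesis by (simp add: algebra_simps)
qed

lemma grad_product_self:
  fixes \<Omega> :: "(real^'n) set"
  shows "grad_product \<Omega> u u = of_real ((norm_L2 (lebesgue_on \<Omega>) (weak_grad \<Omega> u))\<^sup>2)"
proof -
  have "(norm z)\<^sup>2 = (\<Sum>i\<in>UNIV. (cmod (z $ i))\<^sup>2)" for z :: "complex^'n"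
    by (simp add: norm_vec_def L2_set_def sum_nonneg)
  then show ?thesis
    unfolding grad_product_def norm_L2_square
    by (simp add: complex_norm_square[symmetric] del: of_real_sum of_real_power
        flip: integral_complex_of_real of_real_sum of_real_power)
qed

lemma boundary_product_self:
  "boundary_product \<Omega> \<sigma> u u = of_real ((norm_L2 \<sigma> (trace \<Omega> \<sigma> u))\<^sup>2)"
  unfolding boundary_product_def norm_L2_square
  by (simp add: complex_norm_square[symmetric] flip: integral_complex_of_real of_real_power)

text \<open>Weak solutions of \<open>-\<Delta>u - k\<^sup>2 (1 + m) u = f\<close> with \<open>\<partial>\<^sub>n u = i k u\<close>, in a
medium with contrast \<open>m\<close>. The scattering problem is the case \<open>m = q w\<close>, \<open>f = k\<^sup>2 q w u0\<close>; the two estimates below only see bounds on \<open>m\<close> and \<open>f\<close>.\<close>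

definition helmholtz_medium_solution ::
  "(real^'n) set \<Rightarrow> (real^'n) measure \<Rightarrow> real \<Rightarrow> (real^'n \<Rightarrow> real) \<Rightarrow> (real^'n \<Rightarrow> complex) \<Rightarrow>
     (real^'n \<Rightarrow> complex) \<Rightarrow> bool" where
  "helmholtz_medium_solution \<Omega> \<sigma> k m f u \<longleftrightarrow>
     u \<in> sobolev 1 \<Omega> \<and>
     (\<forall>v\<in>sobolev 1 \<Omega>.
        grad_product \<Omega> u v
          - complex_of_real (k\<^sup>2) * (LINT x|lebesgue_on \<Omega>. complex_of_real (1 + m x) * u x * cnj (v x))
          - \<i> * complex_of_real k * boundary_product \<Omega> \<sigma> u v
        = (LINT x|lebesgue_on \<Omega>. f x * cnj (v x)))"

text \<open>Testing with \<open>v = u\<close> turns the weak form into a complex number whose real part is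
\<open>\<parallel>\<nabla>u\<parallel>\<^sup>2 - k\<^sup>2 \<integral> (1 + m) |u|\<^sup>2\<close> and whose imaginary part is \<open>-k\<close> times the squared norm of the trace.
Its modulus is at most \<open>\<parallel>f\<parallel> \<parallel>u\<parallel>\<close>, and it is bounded below by \<open>cmod_coercive\<close> and the
Poincare-type inequality.\<close>

lemma helmholtz_energy_estimate:
  assumes sol: "helmholtz_medium_solution \<Omega> \<sigma> k m f u"
    and lam: "trace_poincare_constant \<Omega> \<sigma> lam"
    and k: "0 < k" and f: "in_L2 (lebesgue_on \<Omega>) f"
    and upper: "AE x in lebesgue_on \<Omega>. m x \<le> \<mu>" and \<mu>: "0 \<le> \<mu>"
  shows "(lam * min 1 k / sqrt 2 - k\<^sup>2 * (1 + \<mu>)) * norm_H1 \<Omega> u \<le> norm_L2 (lebesgue_on \<Omega>) f"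
proof -
  let ?M = "lebesgue_on \<Omega>"
  define N where "N = norm_L2 ?M u"
  define H where "H = norm_H1 \<Omega> u"
  define A where "A = (norm_L2 ?M (weak_grad \<Omega> u))\<^sup>2"
  define B where "B = (norm_L2 \<sigma> (trace \<Omega> \<sigma> u))\<^sup>2"
  define r where "r = (LINT x|?M. (1 + m x) * (cmod (u x))\<^sup>2)"
  let ?c = "lam * min 1 k / sqrt 2 - k\<^sup>2 * (1 + \<mu>)"
  have u: "u \<in> sobolev 1 \<Omega>" "in_L2 ?M u"
    using sol by (auto simp: helmholtz_medium_solution_def sobolev_def)
  have N: "0 \<le> N" "N \<le> H" and AB: "0 \<le> A" "0 \<le> B"
    by (auto simp: N_def H_def A_def B_def norm_L2_nonneg norm_L2_le_norm_H1)
  have r_le: "r \<le> (1 + \<mu>) * N\<^sup>2"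
  proof (cases "integrable ?M (\<lambda>x. (1 + m x) * (cmod (u x))\<^sup>2)")
    case True
    have int: "integrable ?M (\<lambda>x. (1 + \<mu>) * (cmod (u x))\<^sup>2)"
      using u by (simp add: in_L2_def)
    have "r \<le> (LINT x|?M. (1 + \<mu>) * (cmod (u x))\<^sup>2)"
      unfolding r_def
      by (rule integral_mono_AE[OF True int]) (use upper in eventually_elim, auto intro!: mult_right_mono)
    then show ?thesis by (simp add: N_def norm_L2_square)
  next
    case False
    \<comment> \<open>Without integrability the integral is \<open>0\<close> by convention, and the bound holds trivially.\<close>
    then show ?thesis using \<mu> by (simp add: r_def not_integrable_integral_eq)
  qed
  have "of_real A - of_real (k\<^sup>2 * r) - \<i> * of_real k * of_real B = (LINT x|?M. f x * cnj (u x))"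
  proof -
    have "(LINT x|?M. complex_of_real (1 + m x) * u x * cnj (u x)) = of_real r"
      unfolding r_def integral_complex_of_real[symmetric]
      by (rule Bochner_Integration.integral_cong)
        (auto simp: mult.assoc complex_norm_square[symmetric] simp del: of_real_power simp flip: of_real_power)
    then show ?thesis
      using sol u(1) unfolding helmholtz_medium_solution_def
      by (auto simp: A_def B_def grad_product_self boundary_product_self)
  qed
  then have "cmod (of_real A - of_real (k\<^sup>2 * r) - \<i> * of_real k * of_real B) \<le> norm_L2 ?M f * N"
    using L2_inner_product(2)[OF f u(2)] by (simp add: N_def)
  moreover have "min 1 k / sqrt 2 * (A + B) \<le> k\<^sup>2 * ((1 + \<mu>) * N\<^sup>2)
      + cmod (of_real A - of_real (k\<^sup>2 * r) - \<i> * of_real k * of_real B)"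
    by (rule cmod_coercive) (use AB k r_le \<mu> in \<open>auto intro!: mult_left_mono\<close>)
  moreover have "min 1 k / sqrt 2 * (lam * H\<^sup>2) \<le> min 1 k / sqrt 2 * (A + B)"
  proof (rule mult_left_mono)
    have "sqrt lam * H \<le> sqrt (B + A)" "0 < lam"
      using lam u(1) by (auto simp: trace_poincare_constant_def A_def B_def H_def)
    then have "(sqrt lam * H)\<^sup>2 \<le> (sqrt (B + A))\<^sup>2"
      using N by (intro power_mono) auto
    then show "lam * H\<^sup>2 \<le> A + B"
      using AB \<open>0 < lam\<close> by (simp add: power_mult_distrib add.commute)
  qed (use k in simp)
  moreover have "k\<^sup>2 * ((1 + \<mu>) * N\<^sup>2) \<le> k\<^sup>2 * ((1 + \<mu>) * H\<^sup>2)"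
    using N \<mu> by (intro mult_left_mono power_mono) auto
  moreover have "norm_L2 ?M f * N \<le> norm_L2 ?M f * H"
    using N by (intro mult_left_mono) (auto simp: norm_L2_nonneg)
  ultimately have "?c * H\<^sup>2 \<le> norm_L2 ?M f * H"
    by (simp add: algebra_simps)
  then have *: "(?c * H) * H \<le> norm_L2 ?M f * H"
    by (simp add: power2_eq_square mult.assoc)
  show ?thesis
  proof (cases "H = 0")
    case True
    then show ?thesis by (simp add: H_def norm_L2_nonneg)
  next
    case False
    with N have "0 < H" by simp
    with * show ?thesis unfolding H_def by simp
  qed
qed

text \<open>Moving the contrast to the right-hand side, \<open>u\<close> solves the constant-coefficient Helmholtz problem
with source \<open>g = k\<^sup>2 m u + f\<close>, so the regularity estimate applies. The norm of \<open>u\<close> remains on the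
right and is controlled by the energy estimate.\<close>

lemma helmholtz_H2_estimate:
  assumes sol: "helmholtz_medium_solution \<Omega> \<sigma> k m f u"
    and C: "H2_regularity_constant \<Omega> \<sigma> C"
    and k: "0 < k" and f: "in_L2 (lebesgue_on \<Omega>) f"
    and m: "m \<in> borel_measurable (lebesgue_on \<Omega>)"
    and bound: "AE x in lebesgue_on \<Omega>. \<bar>m x\<bar> \<le> Q" and Q: "0 \<le> Q"
  shows "u \<in> sobolev 2 \<Omega>"
    and "seminorm_H2 \<Omega> u \<le> C * (1 + k) *
      (k\<^sup>2 * Q * norm_L2 (lebesgue_on \<Omega>) u + norm_L2 (lebesgue_on \<Omega>) f)"
proof -
  let ?M = "lebesgue_on \<Omega>"
  define h where "h x = complex_of_real (k\<^sup>2 * m x) * u x" for x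
  define g where "g x = h x + f x" for x
  have u: "u \<in> sobolev 1 \<Omega>" "in_L2 ?M u"
    using sol by (auto simp: helmholtz_medium_solution_def sobolev_def)
  have "h \<in> borel_measurable ?M"
    unfolding h_def using m u by (auto simp: in_L2_def)
  moreover have "AE x in ?M. norm (h x) \<le> k\<^sup>2 * Q * norm (u x)"
    using bound by eventually_elim
      (auto simp: h_def norm_mult norm_power abs_mult intro!: mult_right_mono mult_left_mono)
  ultimately have h: "in_L2 ?M h" "norm_L2 ?M h \<le> k\<^sup>2 * Q * norm_L2 ?M u"
    using L2_dominated[OF u(2), of h "k\<^sup>2 * Q"] Q by auto
  have g: "in_L2 ?M g" "norm_L2 ?M g \<le> k\<^sup>2 * Q * norm_L2 ?M u + norm_L2 ?M f"
    unfolding g_def using norm_L2_triangle[OF h(1) f] h(2) by auto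
  have "helmholtz_robin_solution \<Omega> \<sigma> k 1 g u"
    unfolding helmholtz_robin_solution_def
  proof (intro conjI ballI u(1))
    fix v assume v: "v \<in> sobolev 1 \<Omega>"
    then have v2: "in_L2 ?M v" by (simp add: sobolev_def)
    have int: "integrable ?M (\<lambda>x. u x * cnj (v x))" "integrable ?M (\<lambda>x. h x * cnj (v x))"
      "integrable ?M (\<lambda>x. f x * cnj (v x))"
      by (intro L2_inner_product(1) u(2) h(1) f v2)+
    have "of_real (k\<^sup>2) * (LINT x|?M. complex_of_real (1 + m x) * u x * cnj (v x))
        = (LINT x|?M. of_real (k\<^sup>2) * (complex_of_real (1 + m x) * u x * cnj (v x)))"
      by simp
    also have "\<dots> = (LINT x|?M. of_real (k\<^sup>2) * (u x * cnj (v x)) + h x * cnj (v x))"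
      by (rule Bochner_Integration.integral_cong) (auto simp: h_def algebra_simps)
    also have "\<dots> = of_real (k\<^sup>2) * (LINT x|?M. u x * cnj (v x)) + (LINT x|?M. h x * cnj (v x))"
      using int by simp
    finally have split: "of_real (k\<^sup>2) * (LINT x|?M. complex_of_real (1 + m x) * u x * cnj (v x)) = \<dots>" .
    have "(LINT x|?M. g x * cnj (v x)) = (LINT x|?M. h x * cnj (v x)) + (LINT x|?M. f x * cnj (v x))"
      using int by (simp add: g_def distrib_right)
    moreover have "grad_product \<Omega> u v
          - of_real (k\<^sup>2) * (LINT x|?M. complex_of_real (1 + m x) * u x * cnj (v x))
          - \<i> * of_real k * boundary_product \<Omega> \<sigma> u v = (LINT x|?M. f x * cnj (v x))"
      using sol v by (auto simp: helmholtz_medium_solution_def)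
    ultimately show "grad_product \<Omega> u v
          - complex_of_real (k\<^sup>2) * (LINT x|?M. u x * cnj (v x))
          - complex_of_real 1 * \<i> * complex_of_real k * boundary_product \<Omega> \<sigma> u v
        = (LINT x|?M. g x * cnj (v x))"
      unfolding split by (simp add: algebra_simps)
  qed
  then have reg: "u \<in> sobolev 2 \<Omega>" "seminorm_H2 \<Omega> u \<le> C * (1 + \<bar>k\<bar>) * norm_L2 ?M g" "0 < C"
    using C k g(1) unfolding H2_regularity_constant_def by blast+
  show "u \<in> sobolev 2 \<Omega>" by (rule reg(1))
  have "C * (1 + k) * norm_L2 ?M g \<le> C * (1 + k) * (k\<^sup>2 * Q * norm_L2 ?M u + norm_L2 ?M f)"
    using reg(3) k g(2) by (intro mult_left_mono) auto
  with reg(2) k show "seminorm_H2 \<Omega> u \<le> C * (1 + k) * (k\<^sup>2 * Q * norm_L2 ?M u + norm_L2 ?M f)"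
    by simp
qed


section \<open>The uniform bound\<close>

theorem proposition4p10:
  fixes p a b d :: "real^2"
    and \<Omega> \<Omega>' :: "(real^2) set"
    and \<sigma> :: "(real^2) measure"
    and wl wu qt k0 lam C c3 c c1 c2 :: real
    and q w :: "real^2 \<Rightarrow> real"
    and u u0 :: "real^2 \<Rightarrow> complex"
  assumes "is_square_frame a b"
    and "\<Omega> = open_square p a b"
    and "\<sigma> = boundary_measure p a b"
    and "trace_poincare_constant \<Omega> \<sigma> lam"
    and "H2_regularity_constant \<Omega> \<sigma> C"
    and "H2_Linf_embedding_constant \<Omega> c3"
    and "wl < wu" and "qt > 0" and "k0 > 0"
    and "min 1 k0 / sqrt 2 * lam > k0\<^sup>2 * (1 + qt * max 0 wu)"
    and "c = lam * min 1 k0 / sqrt 2 - k0\<^sup>2 * (1 + qt * max 0 wu)"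
    and "c1 = C * (1 + \<bar>k0\<bar>) * k0\<^sup>2 * qt * max (- wl) wu"
    and "c2 = inverse c * k0\<^sup>2 * qt * max (- wl) wu"
    and "\<Omega>' \<in> sets lebesgue" and "\<Omega>' \<subseteq> \<Omega>"
    and "q = (\<lambda>x. qt * indicator \<Omega>' x)"
    and "u0 = plane_wave k0 d"
    and "w \<in> W_ad (lebesgue_on \<Omega>) wl wu"
    and "u \<in> sobolev 1 \<Omega>"
    and "\<forall>v\<in>sobolev 1 \<Omega>.
           grad_product \<Omega> u v
             - complex_of_real (k0\<^sup>2) *
                 (LINT x|lebesgue_on \<Omega>. complex_of_real (1 + q x * w x) * u x * cnj (v x))
             - \<i> * complex_of_real k0 * boundary_product \<Omega> \<sigma> u v
           = complex_of_real (k0\<^sup>2) *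
                 (LINT x|lebesgue_on \<Omega>. complex_of_real (q x * w x) * u0 x * cnj (v x))"
  shows "norm_Linf (lebesgue_on \<Omega>) u
           \<le> ereal (sqrt 2 * c3 * (c1 + c1 * c2 + c2) * norm_L2 (lebesgue_on \<Omega>) u0)"
proof -
  note frame = assms(1) and \<Omega>_def = assms(2) and poincare = assms(4) and regular = assms(5)
    and embed = assms(6) and wl_wu = assms(7) and qt = assms(8) and k0 = assms(9) and gap = assms(10)
    and c_def = assms(11) and c1_def = assms(12) and c2_def = assms(13) and \<Omega>' = assms(14)
    and q_def = assms(16) and u0_def = assms(17) and w = assms(18) and u = assms(19) and weak = assms(20)
  let ?M = "lebesgue_on \<Omega>"
  define \<mu> where "\<mu> = qt * max 0 wu"
  define Q where "Q = qt * max (- wl) wu"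
  define m where "m x = q x * w x" for x
  define f where "f x = complex_of_real (k0\<^sup>2 * m x) * u0 x" for x
  define U where "U = norm_L2 ?M u0"

  have \<Omega>: "open \<Omega>" "bounded \<Omega>" "\<Omega> \<noteq> {}"
    using open_square_properties[OF frame] by (simp_all add: \<Omega>_def)
  have lm: "\<Omega> \<in> lmeasurable"
    by (rule lmeasurable_open[OF \<Omega>(2,1)])
  have c3: "0 < c3"
    by (rule embedding_constant_pos[OF embed \<Omega>])
  have C: "0 < C"
    using regular by (simp add: H2_regularity_constant_def)
  have \<mu>: "0 \<le> \<mu>" and Q: "0 \<le> Q" and U: "0 \<le> U" and c: "0 < c"
    using qt wl_wu gap by (auto simp: \<mu>_def Q_def U_def c_def norm_L2_nonneg mult.commute)

  have w_meas: "w \<in> borel_measurable ?M" and w_bounds: "AE x in ?M. wl \<le> w x \<and> w x \<le> wu"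
    using w by (auto simp: W_ad_def in_Linf_def)
  have "indicator \<Omega>' \<in> borel_measurable ?M"
    by (intro measurable_restrict_space1 borel_measurable_indicator \<Omega>')
  then have m_meas: "m \<in> borel_measurable ?M"
    using w_meas unfolding m_def[abs_def] q_def by measurable
  have m_upper: "AE x in ?M. m x \<le> \<mu>"
    using w_bounds
    by eventually_elim (use qt in \<open>auto simp: m_def q_def \<mu>_def indicator_def\<close>)
  have m_abs: "AE x in ?M. \<bar>m x\<bar> \<le> Q"
    using w_bounds
    by eventually_elim
      (use qt wl_wu in \<open>auto simp: m_def q_def Q_def indicator_def abs_mult abs_le_iff\<close>)

  have u0_norm: "norm (u0 x) = 1" for x
    unfolding u0_def plane_wave_def by (rule norm_exp_i_times)
  have "u0 \<in> borel_measurable borel"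
    unfolding u0_def plane_wave_def by (intro borel_measurable_continuous_onI continuous_intros)
  then have u0_meas: "u0 \<in> borel_measurable ?M"
    by (intro measurable_restrict_space1 measurable_completion) simp
  have u0: "in_L2 ?M u0"
    using L2_dominated(1)[OF in_L2_const[OF lm, of "1::real"] u0_meas, of 1] u0_norm by simp
  have f_meas: "f \<in> borel_measurable ?M"
    using m_meas u0_meas unfolding f_def[abs_def] by measurable
  have "AE x in ?M. norm (f x) \<le> k0\<^sup>2 * Q * norm (u0 x)"
    using m_abs by eventually_elim
      (simp add: f_def norm_mult norm_power abs_mult u0_norm mult_left_mono)
  then have f: "in_L2 ?M f" "norm_L2 ?M f \<le> k0\<^sup>2 * Q * U"
    using L2_dominated[OF u0 f_meas, of "k0\<^sup>2 * Q"] Q by (auto simp: U_def)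

  have sol: "helmholtz_medium_solution \<Omega> \<sigma> k0 m f u"
    unfolding helmholtz_medium_solution_def
  proof (intro conjI u ballI)
    fix v assume v: "v \<in> sobolev 1 \<Omega>"
    have "(LINT x|?M. f x * cnj (v x))
        = (LINT x|?M. complex_of_real (k0\<^sup>2) * (complex_of_real (q x * w x) * u0 x * cnj (v x)))"
      by (rule Bochner_Integration.integral_cong) (simp_all add: f_def m_def)
    also have "\<dots>
        = complex_of_real (k0\<^sup>2) * (LINT x|?M. complex_of_real (q x * w x) * u0 x * cnj (v x))"
      by (rule integral_mult_right_zero)
    finally have rhs: "(LINT x|?M. f x * cnj (v x)) = \<dots>" .
    show "grad_product \<Omega> u v
        - complex_of_real (k0\<^sup>2) * (LINT x|?M. complex_of_real (1 + m x) * u x * cnj (v x))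
        - \<i> * complex_of_real k0 * boundary_product \<Omega> \<sigma> u v = (LINT x|?M. f x * cnj (v x))"
      unfolding rhs m_def by (rule bspec[OF weak v])
  qed

  have "c * norm_H1 \<Omega> u \<le> k0\<^sup>2 * Q * U"
    using helmholtz_energy_estimate[OF sol poincare k0 f(1) m_upper \<mu>] f(2)
    by (simp add: c_def \<mu>_def mult.commute)
  then have H1: "norm_H1 \<Omega> u \<le> c2 * U"
    using c by (simp add: c2_def Q_def field_simps)
  have c1: "0 \<le> c1" "c1 = C * (1 + k0) * (k0\<^sup>2 * Q)"
    using C k0 Q by (simp_all add: c1_def Q_def mult.assoc)
  have c2: "0 \<le> c2"
    using c Q by (simp add: c2_def Q_def mult.assoc)

  have "seminorm_H2 \<Omega> u \<le> C * (1 + k0) * (k0\<^sup>2 * Q * norm_L2 ?M u + norm_L2 ?M f)"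
    by (rule helmholtz_H2_estimate(2)[OF sol regular k0 f(1) m_meas m_abs Q])
  also have "\<dots> \<le> C * (1 + k0) * (k0\<^sup>2 * Q * (c2 * U) + k0\<^sup>2 * Q * U)"
    using C k0 Q f(2) order_trans[OF norm_L2_le_norm_H1 H1]
    by (intro mult_left_mono add_mono) auto
  also have "\<dots> = (c1 + c1 * c2) * U"
    by (simp add: c1(2) algebra_simps)
  finally have H2: "norm_H2 \<Omega> u \<le> (c1 + c1 * c2 + c2) * U"
    using norm_H2_le[of \<Omega> u] H1 by (simp add: algebra_simps)
  \<comment> \<open>The claimed bound follows by enlarging the right-hand side by the factor \<open>sqrt 2 \<ge> 1\<close>.\<close>
  have "c3 * norm_H2 \<Omega> u \<le> c3 * ((c1 + c1 * c2 + c2) * U)"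
    using H2 c3 by simp
  also have "\<dots> \<le> sqrt 2 * (c3 * ((c1 + c1 * c2 + c2) * U))"
    using mult_right_mono[of 1 "sqrt 2" "c3 * ((c1 + c1 * c2 + c2) * U)"] c3 c1(1) c2 U by simp
  finally have bound: "c3 * norm_H2 \<Omega> u \<le> sqrt 2 * c3 * (c1 + c1 * c2 + c2) * U"
    by (simp add: mult.assoc)
  have "norm_Linf ?M u \<le> ereal (c3 * norm_H2 \<Omega> u)"
    using embed helmholtz_H2_estimate(1)[OF sol regular k0 f(1) m_meas m_abs Q]
    by (simp add: H2_Linf_embedding_constant_def)
  also have "\<dots> \<le> ereal (sqrt 2 * c3 * (c1 + c1 * c2 + c2) * U)"
    using bound by simp
  finally show ?thesis
    by (simp only: U_def)
qed

end
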